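(* Let $G=(V,E)$ be a connected claw-free graph with clique number $\omega(G)=4$. Then one of the following is true: (i) $G$ is the line graph $L(F)$ of a graph $F$ of maximum degree $4$; or (ii) there exists $v\in V$ with $\deg_{G^2}(v)\le 19$ such that the set of all vertices $x\in N_G(v)$ with $\deg_{G^2}(x)\ge 21$ induces a clique in $(G\setminus v)^2$.
   Context: A graph is claw-free if it has no induced $K_{1,3}$. The square $H^2$ of a graph $H$ is the graph on $V(H)$ in which two distinct vertices are adjacent iff they are at distance at most $2$ in $H$. $\deg_{G^2}(v)$ is the degree of $v$ in $G^2$; $N_G(v)$ is the open neighbourhood of $v$ in $G$; $G\setminus v$ is $G$ with $v$ deleted. *)

theory Defs
  imports Main "HOL-Library.Extended_Nat"
begin

record 'a ugraph =
  verts :: "'a set"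
  edges :: "'a set set"

definition simple_graph :: "'a ugraph \<Rightarrow> bool" where
  "simple_graph G \<longleftrightarrow> finite (verts G) \<and> (\<forall>e\<in>edges G. e \<subseteq> verts G \<and> card e = 2)"

definition adj :: "'a ugraph \<Rightarrow> 'a \<Rightarrow> 'a \<Rightarrow> bool" where
  "adj G u v \<longleftrightarrow> {u, v} \<in> edges G"

definition neighbourhood :: "'a ugraph \<Rightarrow> 'a \<Rightarrow> 'a set" where
  "neighbourhood G v = {u \<in> verts G. adj G v u}"

definition degree :: "'a ugraph \<Rightarrow> 'a \<Rightarrow> nat" where
  "degree G v = card (neighbourhood G v)"

definition max_degree :: "'a ugraph \<Rightarrow> nat" where
  "max_degree G = Max (degree G ` verts G)"

definition is_clique :: "'a ugraph \<Rightarrow> 'a set \<Rightarrow> bool" where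
  "is_clique G S \<longleftrightarrow> S \<subseteq> verts G \<and> (\<forall>u\<in>S. \<forall>v\<in>S. u \<noteq> v \<longrightarrow> adj G u v)"

definition clique_number :: "'a ugraph \<Rightarrow> nat" where
  "clique_number G = Max (card ` {S. is_clique G S})"

definition connected_graph :: "'a ugraph \<Rightarrow> bool" where
  "connected_graph G \<longleftrightarrow>
    verts G \<noteq> {} \<and> (\<forall>u\<in>verts G. \<forall>v\<in>verts G. (adj G)\<^sup>*\<^sup>* u v)"

definition induced_subgraph :: "'a ugraph \<Rightarrow> 'a set \<Rightarrow> 'a ugraph" where
  "induced_subgraph G S = \<lparr>verts = S, edges = {e \<in> edges G. e \<subseteq> S}\<rparr>"

definition delete_vertex :: "'a ugraph \<Rightarrow> 'a \<Rightarrow> 'a ugraph" where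
  "delete_vertex G v = induced_subgraph G (verts G - {v})"

definition isomorphic :: "'a ugraph \<Rightarrow> 'b ugraph \<Rightarrow> bool" where
  "isomorphic G H \<longleftrightarrow>
    (\<exists>f. bij_betw f (verts G) (verts H) \<and>
      (\<forall>u\<in>verts G. \<forall>v\<in>verts G. adj G u v \<longleftrightarrow> adj H (f u) (f v)))"

definition complete_bipartite :: "nat \<Rightarrow> nat \<Rightarrow> (nat + nat) ugraph" where
  "complete_bipartite m n =
    \<lparr>verts = {..<m} <+> {..<n}, edges = {{Inl i, Inr j} | i j. i < m \<and> j < n}\<rparr>"

definition claw_free :: "'a ugraph \<Rightarrow> bool" where
  "claw_free G \<longleftrightarrow>
    \<not> (\<exists>S \<subseteq> verts G. isomorphic (induced_subgraph G S) (complete_bipartite 1 3))"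

text \<open>The relation \<open>adj G ^^ n\<close> holds between the ends of the walks of length \<open>n\<close>;
  vertices in different components are at distance \<open>\<infinity>\<close>, the infimum of the empty set.\<close>

definition distance :: "'a ugraph \<Rightarrow> 'a \<Rightarrow> 'a \<Rightarrow> enat" where
  "distance G u v = Inf {enat n | n. (adj G ^^ n) u v}"

definition square :: "'a ugraph \<Rightarrow> 'a ugraph" where
  "square G = \<lparr>verts = verts G,
    edges = {{u, v} | u v. u \<in> verts G \<and> v \<in> verts G \<and> u \<noteq> v \<and> distance G u v \<le> 2}\<rparr>"

definition line_graph :: "'a ugraph \<Rightarrow> 'a set ugraph" where
  "line_graph F = \<lparr>verts = edges F,
    edges = {{e, f} | e f. e \<in> edges F \<and> f \<in> edges F \<and> e \<noteq> f \<and> e \<inter> f \<noteq> {}}\<rparr>"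

end

theory Submission
  imports Defs
begin

text \<open>Call a vertex reducible if it satisfies (ii), and suppose that no vertex is reducible. The
  neighbourhood of \<open>v\<close> has independence number at most 2 and clique number at most 3, and each
  neighbour \<open>u\<close> of \<open>v\<close> has at most 3 neighbours at distance 2 from \<open>v\<close>, so the degree of \<open>v\<close> in the
  square is controlled by how often these second neighbours are shared: one that is reached through \<open>u\<close>
  is adjacent to \<open>u\<close> and to all but at most 2 of the common neighbours of \<open>u\<close> and \<open>v\<close>. Double
  counting shows that square degree at least 21 forces the neighbourhood to be two disjoint triangles
  without edges in between. Hence a vertex of degree at least 7 or at most 4 is reducible, and in the
  remaining cases the neighbourhood is a triangle plus a triangle or an edge, with the cross edges
  forming a matching. The cliques consisting of a vertex and one of its two parts then form a Krausz
  partition of the edges, and these cliques are the vertices of the root graph \<open>F\<close>.\<close>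

subsection \<open>Counting second neighbours\<close>

lemma card_Un3_le: "card (A \<union> B \<union> C) \<le> card A + card B + card C"
  by (rule order_trans[OF card_Un_le]) (simp add: card_Un_le)

lemma two_le_cardI: "\<lbrakk>finite S; a \<in> S; b \<in> S; a \<noteq> b\<rbrakk> \<Longrightarrow> \<not> card S \<le> 1"
  using card_le_Suc0_iff_eq[of S] by auto

text \<open>The arguments are local, so the graph is a bare relation \<open>E\<close> with finite
  neighbourhoods. \<open>claw\<close> and \<open>clique_card\<close> express claw-freeness and
  clique number at most 4.\<close>

locale k5_free_claw_free =
  fixes E :: "'a \<Rightarrow> 'a \<Rightarrow> bool"
  assumes sym: "E u v \<Longrightarrow> E v u"
    and irrefl: "\<not> E v v"
    and fin: "finite {u. E v u}"
    and claw: "\<lbrakk>E a b; E a c; E a d; b \<noteq> c; b \<noteq> d; c \<noteq> d\<rbrakk> \<Longrightarrow> E b c \<or> E b d \<or> E c d"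
    and clique_card: "\<lbrakk>finite S; \<And>a b. \<lbrakk>a \<in> S; b \<in> S; a \<noteq> b\<rbrakk> \<Longrightarrow> E a b\<rbrakk> \<Longrightarrow> card S \<le> 4"
begin

definition nb :: "'a \<Rightarrow> 'a set" where "nb v = {u. E v u}"

text \<open>These are the vertices at distance exactly 2, which makes \<open>sqdeg\<close> the
  degree in the square.\<close>

definition sec :: "'a \<Rightarrow> 'a set" where
  "sec v = {w. w \<noteq> v \<and> \<not> E v w \<and> (\<exists>u. E v u \<and> E u w)}"

definition sqdeg :: "'a \<Rightarrow> nat" where "sqdeg v = card (nb v) + card (sec v)"

definition clq :: "'a set \<Rightarrow> bool" where
  "clq S \<longleftrightarrow> (\<forall>a\<in>S. \<forall>b\<in>S. a \<noteq> b \<longrightarrow> E a b)"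

lemma in_nb [simp]: "u \<in> nb v \<longleftrightarrow> E v u"
  by (simp add: nb_def)

lemma finite_nb [simp]: "finite (nb v)"
  using fin by (simp add: nb_def)

lemma E_commute: "E u v \<longleftrightarrow> E v u"
  using sym by blast

lemma clqD: "\<lbrakk>clq S; a \<in> S; b \<in> S; a \<noteq> b\<rbrakk> \<Longrightarrow> E a b"
  by (auto simp: clq_def)

lemma clq_subset: "\<lbrakk>clq S; T \<subseteq> S\<rbrakk> \<Longrightarrow> clq T"
  by (auto simp: clq_def)

lemma clq_insert: "\<lbrakk>clq S; \<And>b. b \<in> S \<Longrightarrow> E a b\<rbrakk> \<Longrightarrow> clq (insert a S)"
  unfolding clq_def by (metis insertE sym)

lemma clq_diff_subset: "\<lbrakk>clq S; a \<in> S\<rbrakk> \<Longrightarrow> S - {a} \<subseteq> nb a"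
  by (metis DiffD1 DiffD2 clqD in_nb singletonI subsetI)

lemma clq_card: "\<lbrakk>finite S; clq S\<rbrakk> \<Longrightarrow> card S \<le> 4"
  using clique_card by (auto simp: clq_def)

text \<open>Adding \<open>v\<close> itself enlarges the clique by one vertex.\<close>

lemma clq_in_nb_card:
  assumes "S \<subseteq> nb v" "clq S"
  shows "card S \<le> 3"
proof -
  have f: "finite S" using assms(1) finite_subset finite_nb by blast
  have "v \<notin> S" using assms(1) irrefl by auto
  moreover have "clq (insert v S)"
    using assms by (intro clq_insert) auto
  then have "card (insert v S) \<le> 4" using f by (intro clq_card) auto
  ultimately show ?thesis using f by simp
qed

definition outer :: "'a \<Rightarrow> 'a \<Rightarrow> 'a set" where "outer v u = nb u - nb v - {v}"

text \<open>Two nonadjacent members would form a claw with centre \<open>u\<close> and third leaf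
  \<open>v\<close>. In \<open>nonneighbours_clq\<close> the roles are exchanged: the centre is
  \<open>v\<close> and the third leaf is \<open>u\<close>.\<close>

lemma outer_clq:
  assumes "E v u" shows "clq (outer v u)"
  unfolding clq_def outer_def
proof (intro ballI impI)
  fix a b assume "a \<in> nb u - nb v - {v}" "b \<in> nb u - nb v - {v}" "a \<noteq> b"
  then show "E a b" using claw[of u v a b] assms E_commute by auto
qed

lemma outer_card: "E v u \<Longrightarrow> card (outer v u) \<le> 3"
  by (rule clq_in_nb_card[of _ u]) (auto simp: outer_clq, auto simp: outer_def)

lemma nonneighbours_clq:
  assumes "E v u" shows "clq (nb v - nb u - {u})"
  unfolding clq_def
proof (intro ballI impI)
  fix a b assume "a \<in> nb v - nb u - {u}" "b \<in> nb v - nb u - {u}" "a \<noteq> b"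
  then show "E a b" using claw[of v u a b] assms E_commute by auto
qed

text \<open>Besides \<open>u\<close> and the common neighbours, \<open>nb v\<close> holds only the
  clique of nonneighbours of \<open>u\<close>, which has at most 3 vertices.\<close>

lemma nb_card_common:
  assumes "E v u" shows "card (nb v) \<le> card (nb v \<inter> nb u) + 4"
proof -
  have "nb v = (nb v \<inter> nb u) \<union> (nb v - nb u - {u}) \<union> {u}" using assms by auto
  then have "card (nb v) \<le> card (nb v \<inter> nb u) + card (nb v - nb u - {u}) + card {u}"
    using card_Un3_le[of "nb v \<inter> nb u" "nb v - nb u - {u}" "{u}"] by argo
  moreover have "card (nb v - nb u - {u}) \<le> 3"
    using assms by (intro clq_in_nb_card[of _ v] nonneighbours_clq) auto
  ultimately show ?thesis by simp
qed

text \<open>This amounts to \<open>R(3,4) \<le> 10\<close>; the exact value 9 would give 8.\<close>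

lemma nb_card_le_9: "card (nb v) \<le> 9"
proof (cases "\<exists>u u'. E v u \<and> u' \<in> nb v \<inter> nb u")
  case False
  then have "nb v \<inter> nb u = {}" if "E v u" for u using that by auto
  then have "card (nb v) \<le> 4"
    using nb_card_common[of v] by (cases "nb v = {}") auto
  then show ?thesis by simp
next
  case True
  then obtain u u' where u: "E v u" "E v u'" "E u u'" by auto
  \<comment> \<open>The nonneighbours \<open>?P\<close> of \<open>u'\<close> form a clique even
    together with \<open>u\<close>. The neighbours \<open>?Q\<close> of \<open>u'\<close> are
    independent, since an edge among them would complete a clique of five with \<open>v\<close>,
    \<open>u\<close> and \<open>u'\<close>. So each set has at most 2 vertices.\<close>
  let ?P = "nb v \<inter> nb u - nb u' - {u'}" and ?Q = "nb v \<inter> nb u \<inter> nb u'"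
  have "card ?P \<le> 2"
  proof -
    have "clq (insert u ?P)"
      by (rule clq_insert[OF clq_subset[OF nonneighbours_clq[OF u(2)]]]) auto
    then have "card (insert u ?P) \<le> 3"
      using u by (intro clq_in_nb_card[of _ v]) auto
    then show ?thesis using irrefl by simp
  qed
  moreover have "card ?Q \<le> 2"
  proof (rule ccontr)
    assume "\<not> card ?Q \<le> 2"
    then obtain S where S: "S \<subseteq> ?Q" "card S = 3"
      by (metis obtain_subset_with_card_n not_less_eq_eq numeral_2_eq_2 numeral_3_eq_3)
    then obtain a b c where abc: "S = {a,b,c}" "a \<noteq> b" "a \<noteq> c" "b \<noteq> c"
      by (auto simp: card_3_iff)
    have "E a b \<or> E a c \<or> E b c" using S abc by (intro claw[of v]) auto
    moreover have False if "E x y" "x \<in> ?Q" "y \<in> ?Q" for x y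
    proof -
      have "clq {x,y}" using that(1) sym by (auto simp: clq_def)
      then have "clq {u',x,y}" using that by (rule_tac clq_insert) auto
      then have "clq {u,u',x,y}" using that u by (rule_tac clq_insert) auto
      then have "card {u,u',x,y} \<le> 3" using that u by (intro clq_in_nb_card[of _ v]) auto
      moreover have "u \<noteq> u'" "u \<noteq> x" "u \<noteq> y" "u' \<noteq> x" "u' \<noteq> y" "x \<noteq> y"
        using that u irrefl by auto
      ultimately show False by simp
    qed
    ultimately show False using S abc by (metis insert_subset)
  qed
  moreover have "nb v \<inter> nb u = ?P \<union> ?Q \<union> {u'}" using u by auto
  then have "card (nb v \<inter> nb u) \<le> card ?P + card ?Q + card {u'}"
    using card_Un3_le[of ?P ?Q "{u'}"] by argo
  ultimately show ?thesis using nb_card_common[OF u(1)] by simp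
qed

section \<open>Second neighbours reached through a prescribed set\<close>

lemma finite_outer [simp]: "finite (outer v u)"
  by (simp add: outer_def)

lemma sec_eq: "sec v = (\<Union>u\<in>nb v. outer v u)"
  by (auto simp: sec_def outer_def)

lemma finite_sec [simp]: "finite (sec v)"
  by (simp add: sec_eq)

text \<open>The set \<open>K\<close> will be all of \<open>nb v\<close>, the set
  \<open>big v\<close>, a single neighbour, or empty.\<close>

definition only_via :: "'a \<Rightarrow> 'a set \<Rightarrow> 'a set" where
  "only_via v K = {w \<in> sec v. nb w \<inter> nb v \<subseteq> K}"

lemma finite_only_via [simp]: "finite (only_via v K)"
  by (simp add: only_via_def)

text \<open>Each neighbour outside \<open>K\<close> reaches at most 3 second neighbours; those
  missed by all of them are reached through \<open>K\<close> alone.\<close>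

lemma sec_card_only_via:
  assumes "K \<subseteq> nb v"
  shows "card (sec v) \<le> 3 * (card (nb v) - card K) + card (only_via v K)"
proof -
  have "sec v \<subseteq> (\<Union>u\<in>nb v - K. outer v u) \<union> only_via v K"
    using E_commute by (auto simp: sec_def outer_def only_via_def)
  then have "card (sec v) \<le> card ((\<Union>u\<in>nb v - K. outer v u) \<union> only_via v K)"
    by (intro card_mono) auto
  also have "\<dots> \<le> card (\<Union>u\<in>nb v - K. outer v u) + card (only_via v K)"
    by (rule card_Un_le)
  also have "card (\<Union>u\<in>nb v - K. outer v u) \<le> (\<Sum>u\<in>nb v - K. card (outer v u))"
    by (intro card_UN_le) simp
  also have "\<dots> \<le> (\<Sum>u\<in>nb v - K. 3)"
    by (intro sum_mono outer_card) auto
  also have "\<dots> = 3 * (card (nb v) - card K)"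
    using assms finite_subset[OF assms] by (simp add: card_Diff_subset)
  finally show ?thesis by simp
qed

text \<open>Double counting of the edges between \<open>K\<close> and \<open>only_via v K\<close>:
  each \<open>w\<close> receives at least \<open>c\<close> of them and each \<open>u\<close> in
  \<open>K\<close> sends at most 3.\<close>

lemma only_via_card:
  assumes "K \<subseteq> nb v" and c: "\<And>w. w \<in> only_via v K \<Longrightarrow> c \<le> card (nb w \<inter> nb v)"
  shows "c * card (only_via v K) \<le> 3 * card K"
proof -
  have fK: "finite K" using assms(1) by (rule finite_subset) simp
  have "c * card (only_via v K) = (\<Sum>w\<in>only_via v K. c)" by simp
  also have "\<dots> \<le> (\<Sum>w\<in>only_via v K. card {u\<in>K. E u w})"
  proof (rule sum_mono)
    fix w assume w: "w \<in> only_via v K"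
    then have "nb w \<inter> nb v = {u\<in>K. E u w}"
      using assms(1) E_commute by (auto simp: only_via_def)
    then show "c \<le> card {u\<in>K. E u w}" using c[OF w] by simp
  qed
  also have "\<dots> = (\<Sum>u\<in>K. card {w\<in>only_via v K. E u w})"
    using fK by (intro sum_multicount_gen) auto
  also have "\<dots> \<le> (\<Sum>u\<in>K. 3)"
  proof (rule sum_mono)
    fix u assume u: "u \<in> K"
    have "card {w\<in>only_via v K. E u w} \<le> card (outer v u)"
      by (intro card_mono) (auto simp: only_via_def sec_def outer_def)
    then show "card {w\<in>only_via v K. E u w} \<le> 3"
      using outer_card[of v u] u assms(1) by fastforce
  qed
  finally show ?thesis by (simp add: mult.commute)
qed

text \<open>Nonadjacent members would form a claw with centre \<open>u\<close> and third leaf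
  \<open>w\<close>.\<close>

lemma unreached_clq:
  assumes "w \<in> sec v" "E v u" "E u w"
  shows "clq (nb v \<inter> nb u - nb w)"
  unfolding clq_def
proof (intro ballI impI)
  fix a b assume "a \<in> nb v \<inter> nb u - nb w" "b \<in> nb v \<inter> nb u - nb w" "a \<noteq> b"
  then show "E a b" using claw[of u w a b] assms E_commute by (auto simp: sec_def)
qed

text \<open>The common neighbours missed by \<open>w\<close> form a clique with \<open>u\<close>, so
  there are at most 2 of them. The others are reached by \<open>w\<close>, and so is
  \<open>u\<close> itself, which saves one.\<close>

lemma common_card_le_reach:
  assumes "w \<in> sec v" "E v u" "E u w"
  shows "card (nb v \<inter> nb u) \<le> card (nb w \<inter> nb v) + 1"
proof -
  let ?P = "nb v \<inter> nb u - nb w" and ?Q = "nb v \<inter> nb u \<inter> nb w"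
  have "clq (insert u ?P)"
    using unreached_clq[OF assms] by (intro clq_insert) auto
  then have "card (insert u ?P) \<le> 3"
    using assms by (intro clq_in_nb_card[of _ v]) auto
  then have "card ?P \<le> 2" using irrefl by simp
  moreover have "card (insert u ?Q) \<le> card (nb w \<inter> nb v)"
    using assms E_commute by (intro card_mono) auto
  then have "card ?Q + 1 \<le> card (nb w \<inter> nb v)" using irrefl by simp
  moreover have "nb v \<inter> nb u = ?P \<union> ?Q" by auto
  then have "card (nb v \<inter> nb u) \<le> card ?P + card ?Q"
    using card_Un_le[of ?P ?Q] by argo
  ultimately show ?thesis by simp
qed

text \<open>With degree \<open>d\<close>, every second neighbour has at least \<open>d - 5\<close>
  neighbours in \<open>nb v\<close>. Double counting with \<open>K = nb v\<close> leaves at most 10,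
  8 or 6 second neighbours for \<open>d\<close> equal to 7, 8 or 9.\<close>

lemma sqdeg_if_card_ge_7:
  assumes "card (nb v) \<ge> 7" shows "sqdeg v \<le> 17"
proof -
  let ?d = "card (nb v)" and ?R = "only_via v (nb v)"
  have "(?d - 5) * card ?R \<le> 3 * ?d"
  proof (rule only_via_card)
    fix w assume "w \<in> ?R"
    then obtain u where "w \<in> sec v" "E v u" "E u w" by (auto simp: only_via_def sec_def)
    then show "?d - 5 \<le> card (nb w \<inter> nb v)"
      using common_card_le_reach[of w v u] nb_card_common[of v u] by simp
  qed simp
  moreover have "card (sec v) \<le> card ?R"
    using sec_card_only_via[of "nb v" v] by simp
  moreover have "?d \<in> {7,8,9}" using assms nb_card_le_9[of v] by auto
  ultimately show ?thesis unfolding sqdeg_def by auto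
qed

lemma sec_card_le: "card (sec v) \<le> 3 * card (nb v)"
proof -
  have "only_via v {} = {}" using E_commute by (auto simp: only_via_def sec_def)
  then show ?thesis using sec_card_only_via[of "{}" v] by simp
qed

text \<open>By \<open>common_card_le_reach\<close>, 3 is the least threshold that forces each second
  neighbour behind \<open>u\<close> to have at least 2 neighbours in \<open>nb v\<close>.\<close>

definition big :: "'a \<Rightarrow> 'a set" where
  "big v = {u \<in> nb v. card (nb v \<inter> nb u) \<ge> 3}"

lemma big_subset: "big v \<subseteq> nb v"
  by (auto simp: big_def)

lemma finite_big [simp]: "finite (big v)"
  using big_subset by (rule finite_subset) simp

lemma only_via_big:
  assumes "w \<in> only_via v (big v)" shows "card (nb w \<inter> nb v) \<ge> 2"
proof -
  obtain u where u: "w \<in> sec v" "E v u" "E u w" using assms by (auto simp: only_via_def sec_def)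
  then have "u \<in> big v" using assms E_commute by (auto simp: only_via_def)
  then show ?thesis using common_card_le_reach[OF u] by (simp add: big_def)
qed

text \<open>If \<open>big v\<close> has \<open>b\<close> elements, counting gives at most
  \<open>3 * (6 - b) + 3 * b / 2\<close> second neighbours, while at least 14 are needed.\<close>

lemma big_card_le_2:
  assumes "card (nb v) = 6" "sqdeg v \<ge> 20" shows "card (big v) \<le> 2"
proof -
  note b = big_subset[of v]
  have "2 * card (only_via v (big v)) \<le> 3 * card (big v)"
    by (intro only_via_card b only_via_big)
  moreover have "card (big v) \<le> 6" using b assms(1) by (metis card_mono finite_nb)
  ultimately show ?thesis
    using sec_card_only_via[OF b] assms by (simp add: sqdeg_def)
qed

subsection \<open>Neighbourhoods of irreducible vertices\<close>

definition split :: "'a \<Rightarrow> 'a set \<Rightarrow> 'a set \<Rightarrow> bool" where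
  "split v X Y \<longleftrightarrow> nb v = X \<union> Y \<and> X \<inter> Y = {} \<and> clq X \<and> clq Y"

lemma split_commute: "split v X Y \<Longrightarrow> split v Y X"
  by (auto simp: split_def)

lemma split_adj: "split v X Y \<Longrightarrow> E v t \<longleftrightarrow> t \<in> X \<or> t \<in> Y"
  by (metis split_def Un_iff in_nb)

lemma split_finite: "split v X Y \<Longrightarrow> finite X \<and> finite Y"
  by (metis split_def finite_Un finite_nb)

text \<open>A neighbour outside \<open>big v\<close> has exactly 2 common neighbours with
  \<open>v\<close>, hence 3 nonneighbours, which form a clique \<open>T\<close>. Some
  \<open>a\<close> in \<open>T\<close> is again outside \<open>big v\<close>; the rest of
  \<open>T\<close> exhausts its common neighbours, so the complement of \<open>T\<close> is the
  clique of nonneighbours of \<open>a\<close>.\<close>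

lemma split_if_big_card_le_2:
  assumes "card (nb v) = 6" "card (big v) \<le> 2"
  obtains X Y where "split v X Y" "card X = 3" "card Y = 3"
proof -
  note fb = finite_big[of v]
  have two: "card (nb v \<inter> nb u) = 2" if "E v u" "u \<notin> big v" for u
    using nb_card_common[OF that(1)] that assms(1) by (auto simp: big_def)
  have "\<not> nb v \<subseteq> big v"
    using card_mono[OF fb, of "nb v"] assms by linarith
  then obtain u where u: "E v u" "u \<notin> big v" using in_nb by blast
  define T where "T = nb v - nb u - {u}"
  have T: "clq T" using nonneighbours_clq[OF u(1)] by (simp add: T_def)
  have "T = nb v - insert u (nb v \<inter> nb u)" by (auto simp: T_def)
  moreover have "card (insert u (nb v \<inter> nb u)) = 3" using two[OF u] irrefl by simp
  ultimately have cT: "card T = 3" using assms(1) u(1) by (simp add: card_Diff_subset)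
  have "\<not> T \<subseteq> big v"
    using card_mono[OF fb, of T] assms cT by linarith
  then obtain a where a: "a \<in> T" "a \<notin> big v" by auto
  then have va: "E v a" by (simp add: T_def)
  have sub: "T - {a} \<subseteq> nb v \<inter> nb a"
  proof
    fix b assume b: "b \<in> T - {a}"
    then have "E a b" using clqD[OF T a(1), of b] by blast
    then show "b \<in> nb v \<inter> nb a" using b by (simp add: T_def)
  qed
  have fT: "finite T" by (simp add: T_def)
  have "T - {a} = nb v \<inter> nb a"
    using sub two[OF va a(2)] cT a(1) fT by (intro card_subset_eq) auto
  then have eq: "nb v - T = nb v - nb a - {a}" using a(1) by auto
  have "clq (nb v - T)" unfolding eq by (rule nonneighbours_clq[OF va])
  moreover have "card (nb v - T) = 3"
    using assms(1) cT fT by (subst card_Diff_subset) (auto simp: T_def)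
  moreover have "T \<subseteq> nb v" by (auto simp: T_def)
  ultimately show ?thesis using that[of T "nb v - T"] T cT by (auto simp: split_def)
qed

text \<open>An end of a cross edge sees the two other vertices of its own triangle and the opposite
  end.\<close>

lemma split_cross_big:
  assumes "split v X Y" "card X = 3" "card Y = 3" "x \<in> X" "y \<in> Y" "E x y"
  shows "x \<in> big v" "y \<in> big v"
proof -
  have f: "finite X" "finite Y" using assms(2,3) card.infinite by fastforce+
  have v: "E v x" "E v y" "x \<notin> Y" "y \<notin> X" using assms by (auto simp: split_def)
  have "insert y (X - {x}) \<subseteq> nb v \<inter> nb x"
    using assms v by (auto simp: split_def clq_def)
  then have "card (insert y (X - {x})) \<le> card (nb v \<inter> nb x)" by (intro card_mono) auto
  then show "x \<in> big v" using v f assms by (simp add: big_def)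
  have "insert x (Y - {y}) \<subseteq> nb v \<inter> nb y"
    using assms v E_commute by (auto simp: split_def clq_def)
  then have "card (insert x (Y - {y})) \<le> card (nb v \<inter> nb y)" by (intro card_mono) auto
  then show "y \<in> big v" using v f assms by (simp add: big_def)
qed

abbreviation high :: "'a \<Rightarrow> bool" where "high x \<equiv> sqdeg x \<ge> 21"

lemma high_card: assumes "high x" shows "card (nb x) = 6"
proof -
  have "card (nb x) < 7" using sqdeg_if_card_ge_7[of x] assms by linarith
  moreover have "card (nb x) > 5" using sec_card_le[of x] assms by (simp add: sqdeg_def)
  ultimately show ?thesis by simp
qed

text \<open>A cross edge from \<open>a\<close> to \<open>b\<close> would force
  \<open>big x = {a,b}\<close>. The vertices reached only through these two are adjacent to both and
  form a clique with \<open>b\<close> inside \<open>nb a\<close>, so there are at most 2 of them,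
  and the square degree is at most 6 + 12 + 2 = 20.\<close>

lemma high_split:
  assumes "high x"
  obtains X Y where "split x X Y" "card X = 3" "card Y = 3" "\<forall>a\<in>X. \<forall>b\<in>Y. \<not> E a b"
proof -
  have d: "card (nb x) = 6" using assms by (rule high_card)
  have b2: "card (big x) \<le> 2" using assms d by (intro big_card_le_2) auto
  obtain X Y where s: "split x X Y" "card X = 3" "card Y = 3"
    using split_if_big_card_le_2[OF d b2] .
  have "\<not> E a b" if ab: "a \<in> X" "b \<in> Y" for a b
  proof
    assume e: "E a b"
    have ne: "a \<noteq> b" using e irrefl by auto
    note fb = finite_big[of x] and bx = big_subset[of x]
    have "{a,b} \<subseteq> big x" using split_cross_big[OF s ab e] by auto
    then have B: "big x = {a,b}" using b2 ne fb by (metis card_2_iff card_seteq)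
    let ?R = "only_via x (big x)"
    have reach: "nb w \<inter> nb x = {a,b}" if "w \<in> ?R" for w
    proof -
      have "nb w \<inter> nb x \<subseteq> {a,b}" using that B by (auto simp: only_via_def)
      moreover have "card (nb w \<inter> nb x) \<ge> 2" using only_via_big[OF that] .
      ultimately show ?thesis using ne by (intro card_seteq) auto
    qed
    have "E x a" using s ab by (auto simp: split_def)
    have R: "E a w \<and> E b w" if "w \<in> ?R" for w
    proof -
      have "a \<in> nb w" "b \<in> nb w" using reach[OF that] by blast+
      then show ?thesis by (simp add: sym)
    qed
    have "?R \<subseteq> outer x a"
    proof
      fix w assume "w \<in> ?R"
      then show "w \<in> outer x a" using R[of w] by (simp add: outer_def only_via_def sec_def)
    qed
    then have "clq ?R" by (rule clq_subset[OF outer_clq[OF \<open>E x a\<close>]])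
    then have "clq (insert b ?R)" using R by (rule_tac clq_insert) blast+
    moreover have "insert b ?R \<subseteq> nb a" using R e by auto
    ultimately have "card (insert b ?R) \<le> 3" by (intro clq_in_nb_card)
    moreover have "b \<notin> ?R" using s ab by (auto simp: split_def only_via_def sec_def)
    ultimately have "card ?R \<le> 2" by simp
    then show False using sec_card_only_via[OF bx] B ne d assms by (simp add: sqdeg_def)
  qed
  then show ?thesis using s that by blast
qed

text \<open>Without cross edges, the common neighbours are the other two vertices of the triangle
  that contains \<open>v\<close>.\<close>

lemma high_common:
  assumes "high x" "E x v"
  shows "card (nb x \<inter> nb v) = 2" "clq (nb x \<inter> nb v)"
proof -
  obtain X Y where s: "split x X Y" "card X = 3" "card Y = 3"
    and cr: "\<forall>a\<in>X. \<forall>b\<in>Y. \<not> E a b"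
    using high_split[OF assms(1)] .
  have "\<exists>Z. card Z = 3 \<and> v \<in> Z \<and> clq Z \<and> nb x \<inter> nb v = Z - {v}"
  proof (cases "v \<in> X")
    case True
    then have "nb x \<inter> nb v = X - {v}" using s cr irrefl by (auto simp: split_def clq_def)
    then show ?thesis using True s by (auto simp: split_def)
  next
    case False
    then have "v \<in> Y" using assms s by (auto simp: split_def)
    then have "nb x \<inter> nb v = Y - {v}"
      using s cr irrefl E_commute by (auto simp: split_def clq_def)
    then show ?thesis using \<open>v \<in> Y\<close> s by (auto simp: split_def)
  qed
  then show "card (nb x \<inter> nb v) = 2" "clq (nb x \<inter> nb v)" by (auto simp: clq_def)
qed

text \<open>Here all 15 possible second neighbours must occur, so each neighbour \<open>u\<close>
  has a private one, adjacent to no other neighbour of \<open>v\<close>. By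
  \<open>unreached_clq\<close> the common neighbours of \<open>u\<close> and \<open>v\<close> then
  form a clique. So adjacency inside \<open>nb v\<close> is transitive and its components are
  cliques.\<close>

lemma split_card_5:
  assumes "card (nb v) = 5" "sqdeg v \<ge> 20"
  obtains X Y where "split v X Y" "card X = 3" "card Y = 2" "\<forall>a\<in>X. \<forall>b\<in>Y. \<not> E a b"
proof -
  have cl: "clq (nb v \<inter> nb u)" if "E v u" for u
  proof -
    have "card (only_via v {u}) \<ge> 3"
      using sec_card_only_via[of "{u}" v] that assms by (simp add: sqdeg_def)
    then have "only_via v {u} \<noteq> {}" by auto
    then obtain w where w: "w \<in> only_via v {u}" by auto
    then have ws: "w \<in> sec v" and r: "nb w \<inter> nb v \<subseteq> {u}" by (auto simp: only_via_def)
    then obtain u' where "E v u'" "E u' w" by (auto simp: sec_def)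
    then have uw: "E u w" using r E_commute[of u' w] by auto
    have "nb v \<inter> nb u - nb w = nb v \<inter> nb u" using r irrefl by auto
    then show ?thesis using unreached_clq[OF ws that uw] by simp
  qed
  obtain u where u: "E v u" using assms(1) by (metis card.empty equals0I in_nb zero_neq_numeral)
  define C where "C = insert u (nb v \<inter> nb u)"
  define D where "D = nb v - nb u - {u}"
  have "clq C" unfolding C_def using cl[OF u] by (intro clq_insert) auto
  moreover have "C \<subseteq> nb v" using u by (auto simp: C_def)
  ultimately have C: "clq C" "C \<subseteq> nb v" .
  have D: "clq D" "D \<subseteq> nb v" using nonneighbours_clq[OF u] by (auto simp: D_def)
  have cd: "nb v = C \<union> D" "C \<inter> D = {}" using u by (auto simp: C_def D_def)
  have nc: "\<not> E a b" if "a \<in> C" "b \<in> D" for a b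
  proof
    assume "E a b"
    then have "a \<noteq> u" "E v a" "E u a" "E v b" "\<not> E u b" "u \<noteq> b" using that u by (auto simp: C_def D_def)
    then show False using clqD[OF cl[of a], of u b] u \<open>E a b\<close> E_commute by auto
  qed
  have "card C \<le> 3" "card D \<le> 3" using C D clq_in_nb_card by auto
  moreover have "card C + card D = 5"
    using cd assms(1) by (metis card_Un_disjoint finite_Un finite_nb)
  ultimately have "card C = 3 \<and> card D = 2 \<or> card C = 2 \<and> card D = 3" by arith
  then show ?thesis
  proof
    assume "card C = 3 \<and> card D = 2"
    then show ?thesis using that[of C D] cd C D nc by (auto simp: split_def)
  next
    assume "card C = 2 \<and> card D = 3"
    then show ?thesis using that[of D C] cd C D nc sym by (simp add: split_def) blast
  qed
qed

text \<open>The condition \<open>c \<noteq> v\<close> keeps the connecting path in the graph without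
  \<open>v\<close>.\<close>

definition reducible :: "'a \<Rightarrow> bool" where
  "reducible v \<longleftrightarrow> sqdeg v \<le> 19 \<and>
    (\<forall>x y. E v x \<longrightarrow> E v y \<longrightarrow> high x \<longrightarrow> high y \<longrightarrow> x \<noteq> y \<longrightarrow>
      E x y \<or> (\<exists>c. c \<noteq> v \<and> E x c \<and> E c y))"

text \<open>Square degree at least 20 leaves degree 5 or 6, the first two cases. Otherwise two high
  neighbours violate the clique condition, and the triangles around them fill
  \<open>nb v\<close>.\<close>

lemma irreducible_split:
  assumes "\<not> reducible v"
  obtains (five) X Y where "split v X Y" "card X = 3" "card Y = 2" "\<forall>a\<in>X. \<forall>b\<in>Y. \<not> E a b"
  | (cross) X Y where "split v X Y" "card X = 3" "card Y = 3" "card (big v) \<le> 2"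
  | (two_high) X Y x y where "split v X Y" "card X = 3" "card Y = 3" "x \<in> X" "y \<in> Y" "high x" "high y"
proof (cases "sqdeg v \<ge> 20")
  case True
  then have "card (nb v) < 7" using sqdeg_if_card_ge_7[of v] by linarith
  moreover have "card (nb v) > 4" using sec_card_le[of v] True by (simp add: sqdeg_def)
  ultimately consider "card (nb v) = 5" | "card (nb v) = 6" by linarith
  then show ?thesis
  proof cases
    case 1
    then show ?thesis using split_card_5[OF 1 True] five by blast
  next
    case 2
    then show ?thesis using split_if_big_card_le_2[OF 2] big_card_le_2[OF 2 True] cross by blast
  qed
next
  case False
  then have "sqdeg v \<le> 19" by simp
  then obtain x y where xy: "E v x" "E v y" "high x" "high y" "x \<noteq> y" "\<not> E x y"
      "\<And>c. c \<noteq> v \<Longrightarrow> E x c \<Longrightarrow> \<not> E c y"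
    using assms unfolding reducible_def by blast
  let ?X = "insert x (nb x \<inter> nb v)" and ?Y = "insert y (nb y \<inter> nb v)"
  have X: "card ?X = 3" "clq ?X" "?X \<subseteq> nb v"
    using high_common[OF xy(3) sym[OF xy(1)]] xy irrefl clq_insert[of "nb x \<inter> nb v" x] by auto
  have Y: "card ?Y = 3" "clq ?Y" "?Y \<subseteq> nb v"
    using high_common[OF xy(4) sym[OF xy(2)]] xy irrefl clq_insert[of "nb y \<inter> nb v" y] by auto
  \<comment> \<open>A shared vertex would give an edge from \<open>x\<close> to \<open>y\<close> or
    a path of length 2 between them that avoids \<open>v\<close>.\<close>
  have disj: "?X \<inter> ?Y = {}"
  proof -
    have False if "z \<in> ?X" "z \<in> ?Y" for z
      using that xy(5,6) xy(7)[of z] sym[of y x] sym[of y z] irrefl[of v] by auto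
    then show ?thesis by blast
  qed
  have cXY: "card (?X \<union> ?Y) = 6" using X(1) Y(1) disj by (subst card_Un_disjoint) auto
  have "card (nb v) < 7"
  proof (rule ccontr)
    assume "\<not> card (nb v) < 7"
    then have "card (nb v \<inter> nb x) \<ge> 3" using nb_card_common[OF xy(1)] by simp
    then show False using high_common(1)[OF xy(3) sym[OF xy(1)]] by (simp add: Int_commute)
  qed
  moreover have "?X \<union> ?Y \<subseteq> nb v" using X Y by simp
  ultimately have "?X \<union> ?Y = nb v" using cXY by (intro card_seteq) auto
  then show ?thesis using two_high[of ?X ?Y x y] X Y disj xy by (auto simp: split_def)
qed


section \<open>High vertices and edges with four common neighbours\<close>

lemma high_in_split:
  assumes "split v X Y" "card X = 3" "x \<in> X" "high x"
  shows "nb x \<inter> nb v = X - {x}"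
proof -
  have "E x v" using split_adj[OF assms(1)] assms(3) sym by blast
  have "X - {x} \<subseteq> nb x \<inter> nb v"
    using assms(1,3) split_adj[OF assms(1)] clqD[of X x] by (auto simp: split_def)
  moreover have "card (X - {x}) = 2" using assms by simp
  ultimately have "X - {x} = nb x \<inter> nb v"
    using high_common(1)[OF assms(4) \<open>E x v\<close>] by (intro card_seteq) auto
  then show ?thesis by simp
qed

lemma high_common_adj:
  "\<lbrakk>high x; E x y; E x c; E y c; E x d; E y d; c \<noteq> d\<rbrakk> \<Longrightarrow> E c d"
  using clqD[OF high_common(2), of x y c d] by simp

text \<open>The high vertices \<open>x\<close> and \<open>y\<close> have no cross edges. Hence the
  four common neighbours of \<open>t\<close> are the other two vertices of \<open>X\<close> and the
  two vertices of \<open>Y\<close> other than \<open>y\<close>.\<close>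

lemma two_high_apex:
  assumes "split v X Y" "card X = 3" "card Y = 3" "x \<in> X" "y \<in> Y" "high x" "high y"
    and t: "t \<in> X" and four: "card (nb v \<inter> nb t) \<ge> 4"
  shows "\<exists>r a b. nb v = {t,x,r,a,b,y} \<and> distinct [t,x,r,a,b,y] \<and>
    nb v \<inter> nb t = {x,r,a,b} \<and> E x r \<and> E a b \<and> E y a \<and> E y b \<and>
    \<not> E x a \<and> \<not> E x b \<and> \<not> E y x \<and> \<not> E y r"
proof -
  note sp = split_commute[OF assms(1)]
  have XY: "nb v = X \<union> Y" "X \<inter> Y = {}" "clq X" "clq Y" using assms(1) by (auto simp: split_def)
  have fin: "finite X" "finite Y" using XY(1) finite_nb[of v] by simp_all
  have nx: "nb x \<inter> nb v = X - {x}" by (rule high_in_split) fact+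
  have ny: "nb y \<inter> nb v = Y - {y}" by (rule high_in_split[OF sp]) fact+
  have "t \<noteq> x"
  proof
    assume "t = x"
    then have "nb v \<inter> nb t = X - {x}" using nx by auto
    then show False using four assms(2,4) fin by simp
  qed
  have "card (X - {t,x}) = 1" using assms(2,4) t \<open>t \<noteq> x\<close> fin by (simp add: card_Diff_subset)
  then obtain r where "X - {t,x} = {r}" by (rule card_1_singletonE)
  then have X: "X = {t,x,r}" "r \<noteq> t" "r \<noteq> x" using t assms(4) by auto
  have "card (Y - {y}) = 2" using assms(3,5) by simp
  then obtain a b where ab: "Y - {y} = {a,b}" "a \<noteq> b" by (auto simp: card_2_iff)
  then have Y: "Y = {y,a,b}" "a \<noteq> y" "b \<noteq> y" using assms(5) by auto
  have xy: "\<not> E x u" if "u \<in> Y" for u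
  proof
    assume "E x u"
    then have "u \<in> nb x \<inter> nb v" using that split_adj[OF assms(1)] by simp
    then show False using nx that XY(2) by auto
  qed
  have yx: "\<not> E y u" if "u \<in> X" for u
  proof
    assume "E y u"
    then have "u \<in> nb y \<inter> nb v" using that split_adj[OF assms(1)] by simp
    then show False using ny that XY(2) by auto
  qed
  have "nb v \<inter> nb t \<subseteq> {x,r,a,b}" using XY(1) X(1) Y(1) irrefl[of t] yx[OF t] sym[of t y] by auto
  moreover have "card {x,r,a,b} \<le> card (nb v \<inter> nb t)"
  proof -
    have "card {x,r,a,b} \<le> 4" by (simp add: card_insert_if)
    then show ?thesis using four by linarith
  qed
  ultimately have "nb v \<inter> nb t = {x,r,a,b}" by (intro card_seteq) auto
  moreover have "distinct [t,x,r,a,b,y]" using X Y ab \<open>t \<noteq> x\<close> XY(2) by auto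
  moreover have "nb v = {t,x,r,a,b,y}" using XY(1) X Y by auto
  moreover have "E x r" "E a b" "E y a" "E y b"
    using clqD[OF XY(3), of x r] clqD[OF XY(4), of a b] clqD[OF XY(4), of y a]
      clqD[OF XY(4), of y b] X Y ab by auto
  moreover have "\<not> E x a" "\<not> E x b" "\<not> E y x" "\<not> E y r" using xy yx X Y by simp_all
  ultimately show ?thesis by blast
qed

text \<open>In the second alternative cross edges have both ends in \<open>big v\<close>. With four
  common neighbours \<open>t\<close> would be big itself, leaving at most one big vertex to add to
  its two partners in \<open>X\<close>.\<close>

lemma split_common_card_le_3:
  assumes "split v X Y" "card X \<le> 3" "t \<in> X"
    and "(\<forall>a\<in>X. \<forall>b\<in>Y. \<not> E a b) \<or> card X = 3 \<and> card Y = 3 \<and> card (big v) \<le> 2"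
  shows "card (nb v \<inter> nb t) \<le> 3"
  using assms(4)
proof
  assume "\<forall>a\<in>X. \<forall>b\<in>Y. \<not> E a b"
  then have "nb v \<inter> nb t \<subseteq> X" using split_adj[OF assms(1)] assms(3) by auto
  then have "card (nb v \<inter> nb t) \<le> card X" using split_finite[OF assms(1)] by (intro card_mono) auto
  then show ?thesis using assms(2) by simp
next
  assume b: "card X = 3 \<and> card Y = 3 \<and> card (big v) \<le> 2"
  show ?thesis
  proof (rule ccontr)
    assume n: "\<not> card (nb v \<inter> nb t) \<le> 3"
    then have tb: "t \<in> big v" using split_adj[OF assms(1), of t] assms(3) by (simp add: big_def)
    have "u \<in> (X - {t}) \<union> (big v - {t})" if "E v u" "E t u" for u
      using split_cross_big(2)[OF assms(1), of t u] b that assms(3) irrefl[of t]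
        split_adj[OF assms(1), of u] by auto
    then have "nb v \<inter> nb t \<subseteq> (X - {t}) \<union> (big v - {t})" by (meson IntD1 IntD2 in_nb subsetI)
    then have "card (nb v \<inter> nb t) \<le> card ((X - {t}) \<union> (big v - {t}))"
      using split_finite[OF assms(1)] by (intro card_mono) auto
    also have "\<dots> \<le> card (X - {t}) + card (big v - {t})" by (rule card_Un_le)
    also have "\<dots> \<le> 3" using b assms(3) tb by auto
    finally show False using n by simp
  qed
qed

text \<open>\<open>split_common_card_le_3\<close> excludes the first two cases of
  \<open>irreducible_split\<close>. In the third, \<open>s\<close> is the high vertex in the part of
  \<open>t\<close> and \<open>z\<close> the one in the other part.\<close>

lemma apex:
  assumes "\<not> reducible v" "E v t" "card (nb v \<inter> nb t) \<ge> 4"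
  obtains s r a b z where "nb v = {t,s,r,a,b,z}" "distinct [t,s,r,a,b,z]"
    "nb v \<inter> nb t = {s,r,a,b}" "E s r" "E a b" "E z a" "E z b"
    "\<not> E s a" "\<not> E s b" "\<not> E z s" "\<not> E z r" "high s" "high z"
  using assms(1)
proof (cases rule: irreducible_split)
  case (five X Y)
  have "\<forall>a\<in>Y. \<forall>b\<in>X. \<not> E a b" using five(4) sym by blast
  then show ?thesis
    using five split_adj[OF five(1), of t] assms split_common_card_le_3[of v X Y t]
      split_common_card_le_3[OF split_commute[OF five(1)], of t] by auto
next
  case (cross X Y)
  then show ?thesis
    using split_adj[OF cross(1), of t] assms split_common_card_le_3[of v X Y t]
      split_common_card_le_3[OF split_commute[OF cross(1)], of t] by auto
next
  case (two_high X Y x y)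
  note sp = split_commute[OF two_high(1)]
  consider "t \<in> X" | "t \<in> Y" using split_adj[OF two_high(1)] assms(2) by blast
  then show ?thesis
  proof cases
    case 1
    show ?thesis using two_high_apex[OF two_high 1 assms(3)] two_high that by metis
  next
    case 2
    show ?thesis using two_high_apex[OF sp two_high(3,2,5,4,7,6) 2 assms(3)] two_high that by metis
  qed
qed

end

section \<open>Graphs without reducible vertices\<close>

locale irreducible_graph = k5_free_claw_free +
  fixes V :: "'a set"
  assumes finite_V: "finite V"
    and edge_in_V: "E u v \<Longrightarrow> u \<in> V"
    and irreducible: "v \<in> V \<Longrightarrow> \<not> reducible v"
begin

lemma irreducible_end: "E v u \<Longrightarrow> \<not> reducible v"
  using edge_in_V irreducible by blast

text \<open>A vertex \<open>p\<close> adjacent to four other neighbours of \<open>v\<close> makes lemma \<open>apex\<close> applicable at \<open>v\<close>,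
  at \<open>p\<close> and at a third vertex \<open>p'\<close>. The last application makes the vertices \<open>y\<close> and \<open>w\<close> from the
  first two adjacent, which is impossible as \<open>y\<close> is high.\<close>

lemma common_card_le_3:
  assumes "E v p" shows "card (nb v \<inter> nb p) \<le> 3"
proof (rule ccontr)
  assume n: "\<not> card (nb v \<inter> nb p) \<le> 3"
  then have vp: "card (nb v \<inter> nb p) \<ge> 4" by simp
  obtain x q p' q' y where
    v: "nb v = {p,x,q,p',q',y}" "distinct [p,x,q,p',q',y]" "nb v \<inter> nb p = {x,q,p',q'}"
      "E x q" "E p' q'" "E y p'" "E y q'"
      "\<not> E x p'" "\<not> E x q'" "\<not> E y x" "\<not> E y q" "high x" "high y"
    using apex[OF irreducible_end[OF assms] assms vp] .
  have vn: "E v x" "E v q" "E v p'" "E v q'" "E v y" using v(1) by auto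
  have pn: "E p x" "E p q" "E p p'" "E p q'" using v(3) by auto
  have "y \<notin> nb v \<inter> nb p" using v(2) unfolding v(3) by auto
  then have py: "\<not> E p y" using vn by simp
  have pv: "card (nb p \<inter> nb v) \<ge> 4" using n by (simp add: Int_commute)
  obtain s r a b w where
    w: "nb p = {v,s,r,a,b,w}" "distinct [v,s,r,a,b,w]" "nb p \<inter> nb v = {s,r,a,b}"
      "E s r" "E a b" "E w a" "E w b" "\<not> E s a" "\<not> E s b" "\<not> E w s" "\<not> E w r" "high s" "high w"
    using apex[OF irreducible_end[OF sym[OF assms]] sym[OF assms] pv] .
  have pw: "E p w" using w(1) by auto
  have "w \<notin> nb p \<inter> nb v" using w(2) unfolding w(3) by auto
  then have vw: "\<not> E v w" using pw by simp
  have eq: "{s,r,a,b} = {x,q,p',q'}" using v(3) w(3) by (metis Int_commute)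
  \<comment> \<open>Otherwise the nonadjacent \<open>v\<close> and \<open>w\<close> would be common
    neighbours of \<open>p\<close> and the high vertex \<open>x\<close>.\<close>
  have "\<not> E w x"
  proof
    assume "E w x"
    have "E v w"
      by (rule high_common_adj[OF v(12) sym[OF pn(1)] sym[OF vn(1)] sym[OF assms] sym[OF \<open>E w x\<close>] pw])
        (use w(2) in auto)
    then show False using vw by simp
  qed
  \<comment> \<open>Since \<open>w\<close> is adjacent to \<open>a\<close> and \<open>b\<close>, the
    vertex \<open>x\<close> is \<open>s\<close> or \<open>r\<close>. Its nonneighbours
    \<open>p'\<close> and \<open>q'\<close> are therefore \<open>a\<close> and \<open>b\<close>, so
    \<open>w\<close> is adjacent to both.\<close>
  then have "x \<in> {s,r}" using eq w(6,7) by auto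
  then have wc: "E w c" if "c \<in> {s,r,a,b}" "\<not> E x c" "c \<noteq> x" for c
    using that w(4,6,7) sym[OF w(4)] by auto
  have wp: "E w p'" "E w q'" using wc v(2,8,9) eq by auto
  \<comment> \<open>Now \<open>p'\<close> and \<open>q'\<close> have four common neighbours, which
    permits the third use of \<open>apex\<close>.\<close>
  have "{v,y,p,w} \<subseteq> nb p' \<inter> nb q'"
    using sym[OF vn(3)] sym[OF vn(4)] sym[OF v(6)] sym[OF v(7)] sym[OF pn(3)] sym[OF pn(4)]
      sym[OF wp(1)] sym[OF wp(2)] by simp
  moreover have ne: "v \<noteq> y" "v \<noteq> p" "v \<noteq> w" "y \<noteq> p" "y \<noteq> w" "p \<noteq> w"
    using vn(5) assms irrefl w(2) v(2) py pw by auto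
  then have c4: "card {v,y,p,w} = 4" by simp
  ultimately have pq: "4 \<le> card (nb p' \<inter> nb q')" using card_mono[of "nb p' \<inter> nb q'" "{v,y,p,w}"] by simp
  obtain s r a b z where
    z: "nb p' = {q',s,r,a,b,z}" "distinct [q',s,r,a,b,z]" "nb p' \<inter> nb q' = {s,r,a,b}"
      "E s r" "E a b" "E z a" "E z b" "\<not> E s a" "\<not> E s b" "\<not> E z s" "\<not> E z r" "high s" "high z"
    using apex[OF irreducible_end[OF sym[OF vn(3)]] v(5) pq] .
  have "{v,y,p,w} = nb p' \<inter> nb q'"
    using \<open>{v,y,p,w} \<subseteq> nb p' \<inter> nb q'\<close> c4 z(2,3) by (intro card_seteq) auto
  then have eq': "{s,r,a,b} = {v,y,p,w}" using z(3) by simp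
  have p'z: "E p' z" using z(1) by auto
  have "z \<notin> nb p' \<inter> nb q'" using z(2) unfolding z(3) by auto
  then have q'z: "\<not> E q' z" using p'z by simp
  have "q' \<noteq> z" using z(2) by auto
  \<comment> \<open>An edge from \<open>z\<close> to the high vertex \<open>y\<close> would make
    \<open>z\<close> and \<open>q'\<close> common neighbours of \<open>y\<close> and
    \<open>p'\<close>, hence adjacent; the same holds for \<open>w\<close>.\<close>
  have "\<not> E z y"
    using high_common_adj[OF v(13,6,7,5) sym p'z \<open>q' \<noteq> z\<close>] q'z by blast
  moreover have "\<not> E z w"
    using high_common_adj[OF w(13) wp v(5) sym p'z \<open>q' \<noteq> z\<close>] q'z by blast
  \<comment> \<open>As \<open>z\<close> is adjacent to \<open>a\<close> and \<open>b\<close>, the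
    vertices \<open>y\<close> and \<open>w\<close> must be \<open>s\<close> and \<open>r\<close>,
    which are adjacent.\<close>
  ultimately have "y \<notin> {a,b}" "w \<notin> {a,b}" using z(6,7) by auto
  moreover have "y \<in> {s,r,a,b}" "w \<in> {s,r,a,b}" using eq' by simp_all
  ultimately have "E y w \<or> E w y" using z(4) ne(5) by auto
  moreover have "\<not> E y w"
    using high_common_adj[OF v(13,6) sym[OF vn(5)] sym[OF vn(3)] _ sym[OF wp(1)] ne(3)] vw by blast
  ultimately show False using sym by blast
qed


text \<open>Two of the at most three common neighbours of \<open>v\<close> and \<open>x\<close>
  already lie in \<open>X\<close>.\<close>

lemma split_cross_card:
  assumes "split v X Y" "card X = 3" "card Y = 3" "x \<in> X"
  shows "card (Y \<inter> nb x) \<le> 1"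
proof -
  have vx: "E v x" using split_adj[OF assms(1)] assms(4) by blast
  have "x \<notin> Y" "clq X" using assms(1,4) by (auto simp: split_def)
  have "(X - {x}) \<union> (Y \<inter> nb x) \<subseteq> nb v \<inter> nb x"
    using split_adj[OF assms(1)] clq_diff_subset[OF \<open>clq X\<close> assms(4)] by auto
  then have "card ((X - {x}) \<union> (Y \<inter> nb x)) \<le> 3"
    using common_card_le_3[OF vx] by (meson card_mono finite_Int finite_nb order_trans)
  moreover have "card ((X - {x}) \<union> (Y \<inter> nb x)) = card (X - {x}) + card (Y \<inter> nb x)"
    using split_finite[OF assms(1)] assms(1) by (intro card_Un_disjoint) (auto simp: split_def)
  ultimately show ?thesis using assms(2,4) by simp
qed

text \<open>The bounds by 1 say that the cross edges form a matching, so that no triangle in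
  \<open>nb v\<close> meets both parts.\<close>

definition linear_split :: "'a \<Rightarrow> 'a set \<Rightarrow> 'a set \<Rightarrow> bool" where
  "linear_split v X Y \<longleftrightarrow> split v X Y \<and> card X = 3 \<and>
    (card Y = 3 \<or> card Y = 2 \<and> (\<forall>x\<in>X. \<forall>y\<in>Y. \<not> E x y)) \<and>
    (\<forall>x\<in>X. card (Y \<inter> nb x) \<le> 1) \<and> (\<forall>y\<in>Y. card (X \<inter> nb y) \<le> 1)"

lemma linear_split_exists:
  assumes "v \<in> V" shows "\<exists>X Y. linear_split v X Y"
proof -
  have "\<exists>X Y. split v X Y \<and> card X = 3 \<and>
      (card Y = 3 \<or> card Y = 2 \<and> (\<forall>x\<in>X. \<forall>y\<in>Y. \<not> E x y))"
    using irreducible[OF assms] by (rule irreducible_split) blast+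
  then obtain X Y where s: "split v X Y" "card X = 3"
    and Y: "card Y = 3 \<or> card Y = 2 \<and> (\<forall>x\<in>X. \<forall>y\<in>Y. \<not> E x y)" by blast
  have "card (Y \<inter> nb x) \<le> 1" if "x \<in> X" for x
  proof (cases "card Y = 3")
    case True then show ?thesis using split_cross_card[OF s] that by blast
  next
    case False
    then have "Y \<inter> nb x = {}" using Y that by auto
    then show ?thesis by simp
  qed
  moreover have "card (X \<inter> nb y) \<le> 1" if "y \<in> Y" for y
  proof (cases "card Y = 3")
    case True then show ?thesis using split_cross_card[OF split_commute[OF s(1)] _ s(2)] that by blast
  next
    case False
    then have "\<not> E y x" if "x \<in> X" for x using Y \<open>y \<in> Y\<close> that sym by blast
    then have "X \<inter> nb y = {}" by auto
    then show ?thesis by simp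
  qed
  ultimately show ?thesis using s Y unfolding linear_split_def by blast
qed

text \<open>Both parts are projections of one chosen pair, so they belong to the same split.\<close>

definition left :: "'a \<Rightarrow> 'a set" where "left v = fst (SOME p. linear_split v (fst p) (snd p))"
definition right :: "'a \<Rightarrow> 'a set" where "right v = snd (SOME p. linear_split v (fst p) (snd p))"

lemma linear_split_left_right:
  assumes "v \<in> V" shows "linear_split v (left v) (right v)"
proof -
  obtain X Y where "linear_split v X Y" using linear_split_exists[OF assms] by blast
  then have "linear_split v (fst (X, Y)) (snd (X, Y))" by simp
  then show ?thesis
    unfolding left_def right_def by (rule someI[of "\<lambda>p. linear_split v (fst p) (snd p)"])
qed

subsection \<open>The Krausz partition\<close>

text \<open>These two cliques through \<open>v\<close> become vertices of the root graph, and
  \<open>v\<close> becomes the edge joining them.\<close>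

definition krausz :: "'a \<Rightarrow> 'a set set" where
  "krausz v = {insert v (left v), insert v (right v)}"

text \<open>A triangle meeting both parts would have a vertex with two neighbours in the opposite
  part.\<close>

lemma triangle_is_part:
  assumes "linear_split u X Y" "T \<subseteq> nb u" "clq T" "card T = 3"
  shows "T = X \<or> T = Y"
proof -
  have s: "split u X Y" "card X = 3" "card Y \<le> 3"
    and 1: "\<And>x. x \<in> X \<Longrightarrow> card (Y \<inter> nb x) \<le> 1"
    and 2: "\<And>y. y \<in> Y \<Longrightarrow> card (X \<inter> nb y) \<le> 1"
    using assms(1) by (auto simp: linear_split_def)
  have TXY: "T \<subseteq> X \<union> Y" using assms(2) s(1) by (auto simp: split_def)
  have fin: "finite X" "finite Y" using split_finite[OF s(1)] by auto
  have "T \<subseteq> X \<or> T \<subseteq> Y"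
  proof (rule ccontr)
    assume "\<not> ?thesis"
    then obtain a b where ab: "a \<in> T" "a \<in> X" "a \<notin> Y" "b \<in> T" "b \<in> Y" "b \<notin> X" using TXY by blast
    then have "a \<noteq> b" by auto
    have "card (T - {a,b}) = 1" using ab assms(4) \<open>a \<noteq> b\<close> by (simp add: card_Diff_subset)
    then obtain c where "T - {a,b} = {c}" by (rule card_1_singletonE)
    then have c: "c \<in> T" "c \<noteq> a" "c \<noteq> b" by auto
    have e: "E b a" "E b c" "E a b" "E a c" using clqD[OF assms(3)] ab c \<open>a \<noteq> b\<close> by auto
    show False
    proof (cases "c \<in> X")
      case True
      then show ?thesis using two_le_cardI[of "X \<inter> nb b" a c] 2[OF ab(5)] fin e ab c by auto
    next
      case False
      then have "c \<in> Y" using c TXY by auto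
      then show ?thesis using two_le_cardI[of "Y \<inter> nb a" b c] 1[OF ab(2)] fin e ab c by auto
    qed
  qed
  then show ?thesis using s(2,3) assms(4) fin card_seteq[of X T] card_seteq[of Y T] by auto
qed

text \<open>Seen from \<open>u\<close>, the rest of the four-clique \<open>C\<close> is a triangle
  in \<open>nb u\<close>, hence one of its parts.\<close>

lemma krausz_part_card_3:
  assumes "v \<in> V" "split v P Q" "card P = 3" "C = insert v P" "u \<in> C" "u \<noteq> v"
  shows "C \<in> krausz u"
proof -
  have u: "u \<in> P" using assms by simp
  have vu: "E v u" using split_adj[OF assms(2)] u by blast
  have uV: "u \<in> V" using edge_in_V[OF sym[OF vu]] .
  have P: "clq P" "finite P" using assms(2) split_finite by (auto simp: split_def)
  have "v \<notin> P" using split_adj[OF assms(2)] irrefl by blast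
  have "clq C" unfolding assms(4) by (rule clq_insert[OF P(1)]) (simp add: split_adj[OF assms(2)])
  then have "clq (C - {u})" by (rule clq_subset) blast
  moreover have "C - {u} \<subseteq> nb u" using clq_diff_subset[OF \<open>clq C\<close> assms(5)] .
  moreover have "card (C - {u}) = 3" using P(2) assms(3-5) \<open>v \<notin> P\<close> by simp
  ultimately have "C - {u} = left u \<or> C - {u} = right u"
    using triangle_is_part[OF linear_split_left_right[OF uV]] by blast
  then show ?thesis using assms(5) unfolding krausz_def by blast
qed

text \<open>This makes the cliques independent of the vertex from which they are built. Cliques of
  size 4 are settled by \<open>krausz_part_card_3\<close>; a part of size 2 needs a count of common
  neighbours.\<close>

lemma krausz_mem:
  assumes "v \<in> V" "C \<in> krausz v" "u \<in> C"
  shows "C \<in> krausz u"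
proof (cases "u = v")
  case True then show ?thesis using assms(2) by simp
next
  case ne: False
  have lv: "linear_split v (left v) (right v)" using linear_split_left_right[OF assms(1)] .
  then have s: "split v (left v) (right v)" "card (left v) = 3"
    and Yv: "card (right v) = 3 \<or> card (right v) = 2 \<and> (\<forall>x\<in>left v. \<forall>y\<in>right v. \<not> E x y)"
    by (auto simp: linear_split_def)
  consider "C = insert v (left v)" | "C = insert v (right v)" "card (right v) = 3"
    | "C = insert v (right v)" "card (right v) = 2" using assms(2) Yv by (auto simp: krausz_def)
  then show ?thesis
  proof cases
    case 1
    then show ?thesis using krausz_part_card_3[OF assms(1) s _ assms(3) ne] by blast
  next
    case 2
    then show ?thesis
      using krausz_part_card_3[OF assms(1) split_commute[OF s(1)] _ _ assms(3) ne] by blast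
  next
    case 3
    have u: "u \<in> right v" using 3 assms(3) ne by simp
    have vu: "E v u" using split_adj[OF s(1)] u by blast
    have uV: "u \<in> V" using edge_in_V[OF sym[OF vu]] .
    have lu: "split u (left u) (right u)" "card (left u) = 3" "card (right u) = 3 \<or> card (right u) = 2"
      using linear_split_left_right[OF uV] by (auto simp: linear_split_def)
    have "nb u \<inter> nb v \<subseteq> right v - {u}"
    proof
      fix w assume w: "w \<in> nb u \<inter> nb v"
      then have "w \<notin> left v" using Yv 3(2) u sym[of u w] by auto
      then show "w \<in> right v - {u}" using w split_adj[OF s(1)] irrefl[of u] by auto
    qed
    moreover have "card (right v - {u}) = 1" using u 3(2) by simp
    moreover have "finite (right v)" using split_finite[OF s(1)] by simp
    ultimately have c1: "card (nb u \<inter> nb v) \<le> 1" by (metis card_mono finite_Diff)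
    \<comment> \<open>With at most one common neighbour, \<open>v\<close> cannot lie in a part of
      size 3 at \<open>u\<close>. It lies in a part of size 2, whose other vertex is that common
      neighbour.\<close>
    have small: "card (Z - {v}) \<le> 1 \<and> Z - {v} \<subseteq> nb u \<inter> nb v" if "split u Z W" "v \<in> Z" for Z W
    proof -
      have "clq Z" using that(1) by (simp add: split_def)
      then have "Z - {v} \<subseteq> nb u \<inter> nb v" using split_adj[OF that(1)] clq_diff_subset[OF \<open>clq Z\<close> that(2)] by auto
      then show ?thesis using c1 by (meson card_mono finite_Int finite_nb order_trans)
    qed
    have "v \<notin> left u" using small[OF lu(1)] lu(2) by auto
    then have vY: "v \<in> right u" using split_adj[OF lu(1)] sym[OF vu] by blast
    note sm = small[OF split_commute[OF lu(1)] vY]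
    then have cYu: "card (right u) = 2" using lu(3) vY by auto
    have "right u - {v} \<subseteq> right v - {u}" using sm \<open>nb u \<inter> nb v \<subseteq> right v - {u}\<close> by blast
    moreover have "card (right u - {v}) = 1" using cYu vY by simp
    ultimately have "right u - {v} = right v - {u}"
      using \<open>card (right v - {u}) = 1\<close> \<open>finite (right v)\<close> by (metis card_subset_eq finite_Diff)
    then have "insert u (right u) = insert v (right v)" using u vY by auto
    then show ?thesis using 3(1) by (simp add: krausz_def)
  qed
qed

lemma krausz_self: "C \<in> krausz v \<Longrightarrow> v \<in> C"
  by (auto simp: krausz_def)

lemma krausz_split: "v \<in> V \<Longrightarrow> split v (left v) (right v)"
  using linear_split_left_right by (auto simp: linear_split_def)

lemma krausz_adj:
  assumes "u \<in> V" "v \<in> V"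
  shows "E u v \<longleftrightarrow> u \<noteq> v \<and> krausz u \<inter> krausz v \<noteq> {}"
proof
  assume uv: "E u v"
  then have "u \<in> left v \<or> u \<in> right v" using split_adj[OF krausz_split[OF assms(2)]] sym by blast
  then obtain C where C: "C \<in> krausz v" "u \<in> C" by (auto simp: krausz_def)
  then have "C \<in> krausz u" using krausz_mem[OF assms(2)] by blast
  then show "u \<noteq> v \<and> krausz u \<inter> krausz v \<noteq> {}" using C(1) uv irrefl by blast
next
  assume "u \<noteq> v \<and> krausz u \<inter> krausz v \<noteq> {}"
  then obtain C where C: "u \<noteq> v" "C \<in> krausz u" "C \<in> krausz v" by blast
  then have "v \<in> C" using krausz_self by blast
  then show "E u v" using C split_adj[OF krausz_split[OF assms(1)]] by (auto simp: krausz_def)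
qed

section \<open>The root graph\<close>

lemma krausz_card: assumes "v \<in> V" shows "card (krausz v) = 2"
proof -
  have "insert v (left v) \<noteq> insert v (right v)"
  proof
    assume eq: "insert v (left v) = insert v (right v)"
    have s: "split v (left v) (right v)" using krausz_split[OF assms] .
    then have "v \<notin> left v" "v \<notin> right v" using split_adj[OF s] irrefl[of v] by blast+
    then have "left v = right v" using eq by (simp add: insert_ident)
    then have "left v = {}" using s by (auto simp: split_def)
    then show False using linear_split_left_right[OF assms] by (simp add: linear_split_def)
  qed
  then show ?thesis by (simp add: krausz_def)
qed

text \<open>The two cliques through \<open>v\<close> meet only in \<open>v\<close>, because the
  parts are disjoint. Distinct vertices thus yield distinct edges of the root graph.\<close>

lemma krausz_inj: "inj_on krausz V"
proof (rule inj_onI)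
  fix u v assume uv: "u \<in> V" "v \<in> V" "krausz u = krausz v"
  then have "u \<in> insert v (left v)" "u \<in> insert v (right v)"
    using krausz_self[of "insert v (left v)" u] krausz_self[of "insert v (right v)" u]
    by (auto simp: krausz_def)
  then show "u = v" using krausz_split[OF uv(2)] by (auto simp: split_def)
qed

lemma krausz_clique_card:
  assumes "v \<in> V" "C \<in> krausz v" shows "card C \<le> 4"
proof -
  have "card (left v) \<le> 3 \<and> card (right v) \<le> 3"
    using linear_split_left_right[OF assms(1)] by (auto simp: linear_split_def)
  moreover have "card (insert v S) \<le> 4" if "card S \<le> 3" for S
    using that card_insert_le_m1[of 4 S v] by simp
  ultimately show ?thesis using assms(2) by (auto simp: krausz_def)
qed

lemma krausz_clique_card_4: assumes "v \<in> V" shows "card (insert v (left v)) = 4"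
proof -
  note s = krausz_split[OF assms]
  have "v \<notin> left v"
  proof
    assume "v \<in> left v"
    then have "E v v" using split_adj[OF s] by blast
    then show False using irrefl by blast
  qed
  moreover have "card (left v) = 3"
    using linear_split_left_right[OF assms] unfolding linear_split_def by blast
  moreover have "finite (left v)" using split_finite[OF s] by blast
  ultimately show ?thesis by simp
qed

lemma krausz_in_V: assumes "v \<in> V" "C \<in> krausz v" "u \<in> C" shows "u \<in> V"
proof (cases "u = v")
  case True
  then show ?thesis using assms(1) by blast
next
  case False
  then have "u \<in> left v \<or> u \<in> right v" using assms(2,3) unfolding krausz_def by blast
  then have "E v u" using split_adj[OF krausz_split[OF assms(1)]] by blast
  then show ?thesis by (rule edge_in_V[OF sym])
qed

text \<open>The vertices of \<open>F\<close> are the cliques, coded as natural numbers by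
  \<open>h\<close>, and \<open>f v\<close> is the pair of cliques through \<open>v\<close>. The
  degree of a clique in \<open>F\<close> is its size, at most 4 and attained by
  \<open>insert v (left v)\<close>.\<close>

lemma root_graph_exists:
  assumes "V \<noteq> {}"
  shows "\<exists>F :: nat ugraph. simple_graph F \<and> max_degree F = 4 \<and>
    (\<exists>f. bij_betw f V (edges F) \<and> (\<forall>u\<in>V. \<forall>v\<in>V. E u v \<longleftrightarrow> adj (line_graph F) (f u) (f v)))"
proof -
  define K where "K = (\<Union>v\<in>V. krausz v)"
  have "finite K" using finite_V by (simp add: K_def krausz_def)
  obtain h :: "'a set \<Rightarrow> nat" where h: "inj_on h K"
    using finite_imp_inj_to_nat_seg[OF \<open>finite K\<close>] by auto
  define f where "f v = h ` krausz v" for v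
  define F where "F = \<lparr>verts = h ` K, edges = f ` V\<rparr>"
  have kK: "krausz v \<subseteq> K" if "v \<in> V" for v using that by (auto simp: K_def)
  have f_inj: "inj_on f V"
  proof (rule inj_onI)
    fix u v assume uv: "u \<in> V" "v \<in> V" "f u = f v"
    then have "krausz u = krausz v"
      using inj_on_image_eq_iff[OF h kK[OF uv(1)] kK[OF uv(2)]] by (simp add: f_def)
    then show "u = v" by (rule inj_onD[OF krausz_inj _ uv(1,2)])
  qed
  have f_card: "card (f v) = 2" if "v \<in> V" for v
    unfolding f_def using card_image[OF inj_on_subset[OF h kK[OF that]]] krausz_card[OF that] by simp
  have mem_f: "h C \<in> f v \<longleftrightarrow> C \<in> krausz v" if "C \<in> K" "v \<in> V" for C v
    unfolding f_def using inj_on_image_mem_iff[OF h that(1) kK[OF that(2)]] .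
  have simple: "simple_graph F"
    using \<open>finite K\<close> kK f_card unfolding simple_graph_def F_def by (auto simp: f_def)
  have degree_F: "degree F (h C) = card C" if C: "C \<in> K" for C
  proof -
    obtain w where w: "w \<in> V" "C \<in> krausz w" using C by (auto simp: K_def)
    have CV: "C \<subseteq> V" using krausz_in_V[OF w] by blast
    \<comment> \<open>Both sides are the set of edges of \<open>F\<close> at \<open>h C\<close>,
      counted once by their other ends and once by the members of \<open>C\<close>.\<close>
    have "(\<lambda>n. {h C, n}) ` neighbourhood F (h C) = f ` C"
    proof (intro equalityI subsetI)
      fix e assume "e \<in> (\<lambda>n. {h C, n}) ` neighbourhood F (h C)"
      then obtain n v where v: "e = {h C, n}" "v \<in> V" "{h C, n} = f v"
        by (auto simp: neighbourhood_def adj_def F_def)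
      then have "C \<in> krausz v" using mem_f[OF C v(2)] by blast
      then show "e \<in> f ` C" using v krausz_self by blast
    next
      fix e assume "e \<in> f ` C"
      then obtain v where v: "v \<in> C" "e = f v" by blast
      then have vV: "v \<in> V" using CV by blast
      have "C \<in> krausz v" using krausz_mem[OF w v(1)] .
      then have "h C \<in> f v" using mem_f[OF C vV] by blast
      then obtain n where n: "f v = {h C, n}"
        using f_card[OF vV] by (metis card_2_iff insert_commute insertE singletonD)
      then have "n \<in> h ` K" using kK[OF vV] by (auto simp: f_def)
      then have "n \<in> neighbourhood F (h C)"
        using n vV by (auto simp: neighbourhood_def adj_def F_def)
      then show "e \<in> (\<lambda>n. {h C, n}) ` neighbourhood F (h C)" using n v(2) by blast
    qed
    moreover have "card ((\<lambda>n. {h C, n}) ` neighbourhood F (h C)) = degree F (h C)"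
      unfolding degree_def by (intro card_image inj_onI) (auto simp: doubleton_eq_iff)
    moreover have "card (f ` C) = card C"
      by (rule card_image[OF inj_on_subset[OF f_inj CV]])
    ultimately show ?thesis by simp
  qed
  have "degree F ` verts F = (\<lambda>C. degree F (h C)) ` K" by (simp add: F_def image_image)
  also have "\<dots> = card ` K" using degree_F by (intro image_cong) auto
  finally have degrees: "degree F ` verts F = card ` K" .
  have "max_degree F = 4"
    unfolding max_degree_def degrees
  proof (rule Max_eqI)
    show "finite (card ` K)" using \<open>finite K\<close> by simp
    show "d \<le> 4" if "d \<in> card ` K" for d
      using that krausz_clique_card by (auto simp: K_def)
    obtain v where v: "v \<in> V" using assms by blast
    then have "insert v (left v) \<in> K" by (auto simp: K_def krausz_def)
    then show "4 \<in> card ` K" using krausz_clique_card_4[OF v] by (metis imageI)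
  qed
  moreover have "bij_betw f V (edges F)" using f_inj by (simp add: bij_betw_def F_def)
  moreover have "E u v \<longleftrightarrow> adj (line_graph F) (f u) (f v)" if uv: "u \<in> V" "v \<in> V" for u v
  proof -
    have "f u \<inter> f v = h ` (krausz u \<inter> krausz v)"
      unfolding f_def using inj_on_image_Int[OF h kK[OF uv(1)] kK[OF uv(2)]] by simp
    moreover have "adj (line_graph F) (f u) (f v) \<longleftrightarrow> f u \<noteq> f v \<and> f u \<inter> f v \<noteq> {}"
      using uv by (auto simp: adj_def line_graph_def F_def doubleton_eq_iff)
    ultimately show ?thesis
      using krausz_adj[OF uv] inj_on_eq_iff[OF f_inj uv] by simp
  qed
  ultimately show ?thesis using simple by blast
qed

end

subsection \<open>Squares, claws and cliques of graphs\<close>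

text \<open>An infimum of a nonempty set of \<open>enat\<close> is attained, so a bound by 2 yields
  a walk of length 0, 1 or 2.\<close>

lemma distance_le_2_iff:
  "distance G u v \<le> 2 \<longleftrightarrow> u = v \<or> adj G u v \<or> (\<exists>c. adj G u c \<and> adj G c v)"
proof
  assume le: "distance G u v \<le> 2"
  let ?A = "{enat n | n. (adj G ^^ n) u v}"
  have "?A \<noteq> {}"
  proof
    assume empty: "?A = {}"
    show False using le unfolding distance_def empty by (simp add: Inf_enat_def)
  qed
  then have "distance G u v \<in> ?A"
    unfolding distance_def Inf_enat_def by (metis (mono_tags, lifting) LeastI ex_in_conv)
  then obtain n where n: "distance G u v = enat n" "(adj G ^^ n) u v" by blast
  then have "n \<le> 2" using le by (simp add: numeral_eq_enat)
  then consider "n = 0" | "n = 1" | "n = 2" by linarith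
  then show "u = v \<or> adj G u v \<or> (\<exists>c. adj G u c \<and> adj G c v)"
    using n(2) by cases (auto simp: numeral_2_eq_2)
next
  have le: "distance G u v \<le> 2" if "(adj G ^^ n) u v" "n \<le> 2" for n
  proof -
    have "distance G u v \<le> enat n" unfolding distance_def using that(1) by (intro Inf_lower) blast
    also have "\<dots> \<le> 2" using that(2) by (simp add: numeral_eq_enat)
    finally show ?thesis .
  qed
  assume "u = v \<or> adj G u v \<or> (\<exists>c. adj G u c \<and> adj G c v)"
  then show "distance G u v \<le> 2"
    using le[of 0] le[of 1] le[of 2] by (auto simp: numeral_2_eq_2)
qed

lemma adj_commute: "adj G u v \<longleftrightarrow> adj G v u"
  by (simp add: adj_def insert_commute)

lemma simple_graph_adj_verts:
  "\<lbrakk>simple_graph G; adj G u v\<rbrakk> \<Longrightarrow> u \<in> verts G \<and> v \<in> verts G \<and> u \<noteq> v"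
  by (auto simp: simple_graph_def adj_def)

lemma adj_square:
  "adj (square G) u v \<longleftrightarrow> u \<in> verts G \<and> v \<in> verts G \<and> u \<noteq> v \<and>
    (adj G u v \<or> (\<exists>c. adj G u c \<and> adj G c v))"
proof -
  \<comment> \<open>Edges are unordered pairs, so the distance first appears in both orders;
    symmetry of \<open>adj\<close> merges them.\<close>
  have "adj (square G) u v \<longleftrightarrow> u \<in> verts G \<and> v \<in> verts G \<and> u \<noteq> v \<and>
    (distance G u v \<le> 2 \<or> distance G v u \<le> 2)"
    by (auto simp: adj_def square_def doubleton_eq_iff)
  then show ?thesis unfolding distance_le_2_iff using adj_commute[of G] by blast
qed

lemma adj_delete_vertex:
  "simple_graph G \<Longrightarrow> adj (delete_vertex G v) a b \<longleftrightarrow> adj G a b \<and> a \<noteq> v \<and> b \<noteq> v"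
  using simple_graph_adj_verts[of G a b] by (auto simp: delete_vertex_def induced_subgraph_def adj_def)

lemma verts_square [simp]: "verts (square G) = verts G"
  by (simp add: square_def)

lemma verts_delete_vertex [simp]: "verts (delete_vertex G v) = verts G - {v}"
  by (simp add: delete_vertex_def induced_subgraph_def)

text \<open>Otherwise \<open>f\<close>, sending the centre \<open>a\<close> to the single vertex on
  the left and the leaves to the right side, is an isomorphism onto the claw.\<close>

lemma claw_free_adj:
  assumes "simple_graph G" "claw_free G"
    and abcd: "adj G a b" "adj G a c" "adj G a d" "b \<noteq> c" "b \<noteq> d" "c \<noteq> d"
  shows "adj G b c \<or> adj G b d \<or> adj G c d"
proof (rule ccontr)
  assume no: "\<not> ?thesis"
  let ?S = "{a,b,c,d}"
  define f :: "'a \<Rightarrow> nat + nat" where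
    "f x = (if x = a then Inl 0 else if x = b then Inr 0 else if x = c then Inr 1 else Inr 2)" for x
  have ne: "a \<noteq> b" "a \<noteq> c" "a \<noteq> d" and S: "?S \<subseteq> verts G"
    using simple_graph_adj_verts[OF assms(1)] abcd by auto
  have f: "f a = Inl 0" "f b = Inr 0" "f c = Inr 1" "f d = Inr 2"
    using ne abcd by (auto simp: f_def)
  have K: "verts (complete_bipartite 1 3) = {Inl 0, Inr 0, Inr 1, Inr 2}"
    by (auto simp: complete_bipartite_def)
  have adjK: "adj (complete_bipartite 1 3) x y \<longleftrightarrow>
      (\<exists>j<3. x = Inl 0 \<and> y = Inr j \<or> y = Inl 0 \<and> x = Inr j)" for x y
    by (auto simp: adj_def complete_bipartite_def doubleton_eq_iff)
  have "bij_betw f ?S (verts (complete_bipartite 1 3))"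
    unfolding bij_betw_def K using f ne abcd by (auto simp: inj_on_def)
  moreover have "adj (induced_subgraph G ?S) x y \<longleftrightarrow> adj (complete_bipartite 1 3) (f x) (f y)"
    if "x \<in> ?S" "y \<in> ?S" for x y
  proof -
    have "adj (induced_subgraph G ?S) x y \<longleftrightarrow> adj G x y"
      using that by (simp add: adj_def induced_subgraph_def)
    moreover have "\<not> adj G z z" for z using simple_graph_adj_verts[OF assms(1)] by blast
    moreover have "adj G b a" "adj G c a" "adj G d a" "\<not> adj G c b" "\<not> adj G d b" "\<not> adj G d c"
      using abcd no adj_commute[of G] by blast+
    moreover have "\<not> adj G b c" "\<not> adj G b d" "\<not> adj G c d" using no by blast+
    moreover note abcd(1-3)
    moreover have "x = a \<or> x = b \<or> x = c \<or> x = d" "y = a \<or> y = b \<or> y = c \<or> y = d"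
      using that by blast+
    ultimately show ?thesis by (elim disjE) (simp_all add: f adjK[unfolded One_nat_def])
  qed
  ultimately have "isomorphic (induced_subgraph G ?S) (complete_bipartite 1 3)"
    unfolding isomorphic_def by (auto simp: induced_subgraph_def)
  then show False using assms(2) S unfolding claw_free_def by blast
qed

text \<open>The locale does not confine \<open>S\<close> to \<open>verts G\<close>. A member outside
  has no neighbours, so \<open>S\<close> is then a singleton.\<close>

lemma clique_card_le:
  assumes "simple_graph G" "finite S" "\<And>a b. \<lbrakk>a \<in> S; b \<in> S; a \<noteq> b\<rbrakk> \<Longrightarrow> adj G a b"
    and "clique_number G = 4"
  shows "card S \<le> 4"
proof (cases "S \<subseteq> verts G")
  case True
  have "{S. is_clique G S} \<subseteq> Pow (verts G)" by (auto simp: is_clique_def)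
  moreover have "finite (Pow (verts G))" using assms(1) by (simp add: simple_graph_def)
  ultimately have "finite {S. is_clique G S}" by (rule finite_subset)
  moreover have "is_clique G S" using True assms(3) by (simp add: is_clique_def)
  ultimately have "card S \<le> Max (card ` {S. is_clique G S})" by (intro Max_ge) auto
  then show ?thesis using assms(4) by (simp add: clique_number_def)
next
  case False
  then obtain a where a: "a \<in> S" "a \<notin> verts G" by blast
  have "b = a" if "b \<in> S" for b
    using assms(3)[OF a(1) that] a(2) simple_graph_adj_verts[OF assms(1), of a b] by blast
  then have "S = {a}" using a(1) by blast
  then show ?thesis by simp
qed

theorem theorem5p3:
  fixes G :: "'a ugraph"
  assumes "simple_graph G"
    and "connected_graph G"
    and "claw_free G"
    and "clique_number G = 4"
  shows "(\<exists>F :: nat ugraph. simple_graph F \<and> max_degree F = 4 \<and> isomorphic G (line_graph F)) \<or>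
    (\<exists>v\<in>verts G. degree (square G) v \<le> 19 \<and>
      is_clique (square (delete_vertex G v))
        {x \<in> neighbourhood G v. degree (square G) x \<ge> 21})"
proof -
  note V = simple_graph_adj_verts[OF assms(1)]
  note sym = adj_commute[of G]
  have "finite (verts G)" using assms(1) by (simp add: simple_graph_def)
  interpret k5_free_claw_free "adj G"
  proof
    show "finite {u. adj G v u}" for v
      using V \<open>finite (verts G)\<close> by (metis (mono_tags) finite_subset mem_Collect_eq subsetI)
    show "card S \<le> 4" if "finite S" "\<And>a b. \<lbrakk>a \<in> S; b \<in> S; a \<noteq> b\<rbrakk> \<Longrightarrow> adj G a b" for S
      using clique_card_le[OF assms(1) that assms(4)] .
    show "adj G b c \<or> adj G b d \<or> adj G c d"
      if "adj G a b" "adj G a c" "adj G a d" "b \<noteq> c" "b \<noteq> d" "c \<noteq> d" for a b c d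
      using claw_free_adj[OF assms(1,3) that] .
  qed (use V sym in auto)
  have deg: "degree (square G) v = sqdeg v" if "v \<in> verts G" for v
  proof -
    have "neighbourhood (square G) v = nb v \<union> sec v"
      using that V irrefl[of v] by (auto simp: neighbourhood_def adj_square sec_def)
    moreover have "nb v \<inter> sec v = {}" by (auto simp: sec_def)
    ultimately show ?thesis by (simp add: degree_def sqdeg_def card_Un_disjoint)
  qed
  show ?thesis
  \<comment> \<open>A reducible vertex gives the second alternative; if there is none, the root
    graph gives the first.\<close>
  proof (cases "\<exists>v\<in>verts G. reducible v")
    case True
    then obtain v where v: "v \<in> verts G" "reducible v" by blast
    have "adj (square (delete_vertex G v)) x y"
      if xy: "x \<in> neighbourhood G v" "y \<in> neighbourhood G v" "high x" "high y" "x \<noteq> y" for x y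
    proof -
      have vxy: "adj G v x" "adj G v y" using xy by (auto simp: neighbourhood_def)
      then have "adj G x y \<or> (\<exists>c. c \<noteq> v \<and> adj G x c \<and> adj G c y)"
        using v(2) xy unfolding reducible_def by blast
      then show ?thesis
        using V[OF vxy(1)] V[OF vxy(2)] xy(5) adj_delete_vertex[OF assms(1), of v]
        by (auto simp: adj_square)
    qed
    then have "is_clique (square (delete_vertex G v)) {x \<in> neighbourhood G v. degree (square G) x \<ge> 21}"
      using deg irrefl[of v] by (auto simp: is_clique_def neighbourhood_def)
    moreover have "degree (square G) v \<le> 19" using v deg by (simp add: reducible_def)
    ultimately show ?thesis using v(1) by blast
  next
    case False
    interpret irreducible_graph "adj G" "verts G"
      using False V \<open>finite (verts G)\<close> by unfold_locales auto
    have "verts G \<noteq> {}" using assms(2) by (simp add: connected_graph_def)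
    then obtain F :: "nat ugraph" and f where "simple_graph F" "max_degree F = 4"
      "bij_betw f (verts G) (edges F)"
      "\<forall>u\<in>verts G. \<forall>v\<in>verts G. adj G u v \<longleftrightarrow> adj (line_graph F) (f u) (f v)"
      using root_graph_exists by blast
    moreover have "verts (line_graph F) = edges F" by (simp add: line_graph_def)
    ultimately show ?thesis unfolding isomorphic_def by metis
  qed
qed

end
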